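(* Let $M$ be a $K$-vector space. Then an $A$-representation structure on $M$ is equivalent to a left $UA$-module structure on $M$.
   Context: All vector spaces and tensor products are over a fixed ground field $K$. A triassociative algebra is a vector space $A$ with three binary operations $\dashv$ (left), $\vdash$ (right), $\bot$ (middle) satisfying for all $x,y,z\in A$: (1) $(x\dashv y)\dashv z=x\dashv(y\dashv z)$; (2) $(x\dashv y)\dashv z=x\dashv(y\vdash z)$; (3) $(x\vdash y)\dashv z=x\vdash(y\dashv z)$; (4) $(x\dashv y)\vdash z=x\vdash(y\vdash z)$; (5) $(x\vdash y)\vdash z=x\vdash(y\vdash z)$; (6) $(x\dashv y)\dashv z=x\dashv(y\,\bot\, z)$; (7) $(x\,\bot\, y)\dashv z=x\,\bot\,(y\dashv z)$; (8) $(x\dashv y)\,\bot\, z=x\,\bot\,(y\vdash z)$; (9) $(x\vdash y)\,\bot\, z=x\vdash(y\,\bot\, z)$; (10) $(x\,\bot\, y)\vdash z=x\vdash(y\vdash z)$; (11) $(x\,\bot\, y)\,\bot\, z=x\,\bot\,(y\,\bot\, z)$. Fix a triassociative algebra $A$. An $A$-representation is a vector space $M$ together with three left operations $\dashv,\vdash,\bot\colon A\otimes M\to M$ and three right operations $\dashv,\vdash,\bot\colon M\otimes A\to M$ satisfying (1)-(11) whenever exactly one of $x,y,z$ is from $M$ and the other two are from $A$. The universal enveloping algebra $UA$ of $A$ is the unital associative $K$-algebra obtained from the tensor algebra (the free unital associative $K$-algebra) $T(\alpha_lA\oplus\alpha_rA\oplus\alpha_mA\oplus\beta_lA\oplus\beta_rA\oplus\beta_mA)$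 on six copies of $A$ (with elements of the copies written $\alpha_l(a)$, $\beta_l(a)$, etc.) by imposing the following $33$ relations for all $a,b\in A$: (1)-(3) $\beta_l(b)\beta_l(a)=\beta_l(a\dashv b)=\beta_l(a\,\bot\,b)=\beta_l(a\vdash b)$; (4)-(6) $\beta_l(b)\alpha_l(a)=\alpha_l(a)\beta_l(b)=\alpha_l(a)\beta_m(b)=\alpha_l(a)\beta_r(b)$; (7)-(9) $\alpha_l(a\dashv b)=\alpha_l(a)\alpha_l(b)=\alpha_l(a)\alpha_m(b)=\alpha_l(a)\alpha_r(b)$; (10)-(12) $\beta_r(a\vdash b)=\beta_r(b)\beta_r(a)=\beta_r(b)\beta_l(a)=\beta_r(b)\beta_m(a)$; (13)-(15) $\alpha_r(a)\beta_r(b)=\beta_r(b)\alpha_r(a)=\beta_r(b)\alpha_l(a)=\beta_r(b)\alpha_m(a)$; (16)-(18) $\alpha_r(a)\alpha_r(b)=\alpha_r(a\vdash b)=\alpha_r(a\dashv b)=\alpha_r(a\,\bot\,b)$; (19) $\beta_l(b)\beta_r(a)=\beta_r(a\dashv b)$; (20) $\beta_l(b)\alpha_r(a)=\alpha_r(a)\beta_l(b)$; (21) $\alpha_l(a\vdash b)=\alpha_r(a)\alpha_l(b)$; (22) $\beta_l(b)\beta_m(a)=\beta_m(a\dashv b)$; (23) $\beta_l(b)\alpha_m(a)=\alpha_m(a)\beta_l(b)$; (24) $\alpha_l(a\,\bot\,b)=\alpha_m(a)\alpha_l(b)$; (25) $\beta_m(b)\beta_l(a)=\beta_m(a\vdash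 b)$; (26) $\beta_m(b)\alpha_l(a)=\alpha_m(a)\beta_r(b)$; (27) $\alpha_m(a\dashv b)=\alpha_m(a)\alpha_r(b)$; (28) $\beta_m(b)\beta_r(a)=\beta_r(a\,\bot\,b)$; (29) $\beta_m(b)\alpha_r(a)=\alpha_r(a)\beta_m(b)$; (30) $\alpha_m(a\vdash b)=\alpha_r(a)\alpha_m(b)$; (31) $\beta_m(b)\beta_m(a)=\beta_m(a\,\bot\,b)$; (32) $\beta_m(b)\alpha_m(a)=\alpha_m(a)\beta_m(b)$; (33) $\alpha_m(a\,\bot\,b)=\alpha_m(a)\alpha_m(b)$. *)

theory Defs
  imports
    "HOL.Vector_Spaces"
    "HOL-Library.FuncSet"
    "HOL-Library.Function_Algebras"
    "HOL-Library.Poly_Mapping"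
    "HOL-Algebra.QuotRing"
    "HOL-Algebra.Module"
begin

section \<open>Triassociative algebras and their representations\<close>

definition bilinear_map ::
  "('k::field \<Rightarrow> 'a::ab_group_add \<Rightarrow> 'a) \<Rightarrow> ('k \<Rightarrow> 'b::ab_group_add \<Rightarrow> 'b) \<Rightarrow>
   ('k \<Rightarrow> 'c::ab_group_add \<Rightarrow> 'c) \<Rightarrow> ('a \<Rightarrow> 'b \<Rightarrow> 'c) \<Rightarrow> bool" where
  "bilinear_map sA sB sC f \<longleftrightarrow>
     (\<forall>x. Vector_Spaces.linear sB sC (f x)) \<and> (\<forall>y. Vector_Spaces.linear sA sC (\<lambda>x. f x y))"

datatype tri = Lft  (* the operation \<stileturn> *)
  | Rgt             (* the operation \<turnstile> *)
  | Mid             (* the operation \<bottom> *)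

(* The quadruple (p, q, r, s) encodes the law (x p y) q z = x r (y s z). The laws are tabulated
   once, so that the same table yields the laws of an algebra (all variables in A) and of a
   representation (exactly one variable in M). *)
definition triassociative_laws :: "(tri \<times> tri \<times> tri \<times> tri) set" where
  "triassociative_laws =
    {(Lft, Lft, Lft, Lft),
     (Lft, Lft, Lft, Rgt),
     (Rgt, Lft, Rgt, Lft),
     (Lft, Rgt, Rgt, Rgt),
     (Rgt, Rgt, Rgt, Rgt),
     (Lft, Lft, Lft, Mid),
     (Mid, Lft, Mid, Lft),
     (Lft, Mid, Mid, Rgt),
     (Rgt, Mid, Rgt, Mid),
     (Mid, Rgt, Rgt, Rgt),
     (Mid, Mid, Mid, Mid)}"

definition triassociative_algebra ::
  "('k::field \<Rightarrow> 'a::ab_group_add \<Rightarrow> 'a) \<Rightarrow> (tri \<Rightarrow> 'a \<Rightarrow> 'a \<Rightarrow> 'a) \<Rightarrow> bool" where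
  "triassociative_algebra sA dot \<longleftrightarrow>
     vector_space sA \<and>
     (\<forall>p. bilinear_map sA sA sA (dot p)) \<and>
     (\<forall>(p, q, r, s) \<in> triassociative_laws. \<forall>x y z.
        dot q (dot p x y) z = dot r x (dot s y z))"

definition is_representation ::
  "('k::field \<Rightarrow> 'a::ab_group_add \<Rightarrow> 'a) \<Rightarrow> (tri \<Rightarrow> 'a \<Rightarrow> 'a \<Rightarrow> 'a) \<Rightarrow>
   ('k \<Rightarrow> 'm::ab_group_add \<Rightarrow> 'm) \<Rightarrow>
   (tri \<Rightarrow> 'a \<Rightarrow> 'm \<Rightarrow> 'm) \<times> (tri \<Rightarrow> 'm \<Rightarrow> 'a \<Rightarrow> 'm) \<Rightarrow> bool" where
  "is_representation sA dot sM = (\<lambda>(lop, rop).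
     (\<forall>p. bilinear_map sA sM sM (lop p)) \<and>
     (\<forall>p. bilinear_map sM sA sM (rop p)) \<and>
     (\<forall>(p, q, r, s) \<in> triassociative_laws. \<forall>a b m.
        rop q (rop p m a) b = rop r m (dot s a b) \<and>
        rop q (lop p a m) b = lop r a (rop s m b) \<and>
        lop q (dot p a b) m = lop r a (lop s b m)))"


section \<open>The tensor algebra of a vector space\<close>

text \<open>
  A \<open>K\<close>-algebra over a type \<open>'k\<close> of scalars is rendered as a record of type \<open>('k, 'r) module\<close>:
  a ring together with a scalar multiplication.
\<close>

definition quotient_algebra :: "('k, 'r) module \<Rightarrow> 'r set \<Rightarrow> ('k, 'r set) module" where
  "quotient_algebra R I =
     ring.extend (R Quot I) (module.fields (\<lambda>c X. \<Union>x\<in>X. I +>\<^bsub>R\<^esub> (c \<odot>\<^bsub>R\<^esub> x)))"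

text \<open>
  The free monoid, written additively as required by \<^theory>\<open>HOL-Library.Poly_Mapping\<close>, where
  \<open>'g \<Rightarrow>\<^sub>0 'k\<close> is the monoid algebra of an additive monoid \<open>'g\<close>.
\<close>

datatype 'v free_monoid = Letters "'v list"

instantiation free_monoid :: (type) monoid_add
begin

definition zero_free_monoid :: "'a free_monoid" where
  "0 = Letters []"

fun plus_free_monoid :: "'a free_monoid \<Rightarrow> 'a free_monoid \<Rightarrow> 'a free_monoid" where
  "Letters xs + Letters ys = Letters (xs @ ys)"

instance
proof
  fix a b c :: "'a free_monoid"
  show "a + b + c = a + (b + c)" by (cases a; cases b; cases c) simp
  show "0 + a = a" "a + 0 = a" by (cases a; simp add: zero_free_monoid_def)+
qed

end

text \<open>The free unital associative algebra on a set of (non-commuting) indeterminates.\<close>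

definition free_algebra :: "('k::field, 'v free_monoid \<Rightarrow>\<^sub>0 'k) module" where
  "free_algebra =
     \<lparr>carrier = UNIV, mult = (*), one = 1, zero = 0, add = (+),
      smult = (\<lambda>c p. Poly_Mapping.map ((*) c) p)\<rparr>"

definition indet :: "'v \<Rightarrow> 'v free_monoid \<Rightarrow>\<^sub>0 'k::field" where
  "indet v = Poly_Mapping.single (Letters [v]) 1"

text \<open>
  The tensor algebra of \<open>V\<close>: the free algebra on the underlying set of \<open>V\<close> modulo linearity
  of the inclusion of \<open>V\<close>. The two-sided ideal generated by these relations is spanned by the
  multilinearity relations between words, so in degree \<open>n\<close> the quotient is the \<open>n\<close>-fold tensor
  power of \<open>V\<close>.
\<close>

definition linearity_ideal ::
  "('k::field \<Rightarrow> 'v::ab_group_add \<Rightarrow> 'v) \<Rightarrow> ('v free_monoid \<Rightarrow>\<^sub>0 'k) set" where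
  "linearity_ideal sV = Idl\<^bsub>free_algebra :: ('k, _) module\<^esub>
     ({indet (v + w) - (indet v + indet w) | v w. True} \<union>
      {indet (sV c v) - Poly_Mapping.map ((*) c) (indet v) | c v. True})"

definition tensor_algebra ::
  "('k::field \<Rightarrow> 'v::ab_group_add \<Rightarrow> 'v) \<Rightarrow> ('k, ('v free_monoid \<Rightarrow>\<^sub>0 'k) set) module" where
  "tensor_algebra sV = quotient_algebra free_algebra (linearity_ideal sV)"

definition tensor_incl ::
  "('k::field \<Rightarrow> 'v::ab_group_add \<Rightarrow> 'v) \<Rightarrow> 'v \<Rightarrow> ('v free_monoid \<Rightarrow>\<^sub>0 'k) set" where
  "tensor_incl sV v = linearity_ideal sV +>\<^bsub>free_algebra\<^esub> indet v"


section \<open>The universal enveloping algebra\<close>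

text \<open>
  The direct sum of six copies of \<open>A\<close> is the space of functions from the type of the six copies
  to \<open>A\<close>, with pointwise operations.
\<close>

datatype copy = Alpha tri | Beta tri

definition copies_scale :: "('k \<Rightarrow> 'a \<Rightarrow> 'a) \<Rightarrow> 'k \<Rightarrow> (copy \<Rightarrow> 'a) \<Rightarrow> (copy \<Rightarrow> 'a)" where
  "copies_scale sA c f = (\<lambda>i. sA c (f i))"

definition in_copy :: "copy \<Rightarrow> 'a::zero \<Rightarrow> (copy \<Rightarrow> 'a)" where
  "in_copy i a = (\<lambda>j. if j = i then a else 0)"

type_synonym ('k, 'a) six_tensors = "((copy \<Rightarrow> 'a) free_monoid \<Rightarrow>\<^sub>0 'k) set"

definition six_tensor_algebra ::
  "('k::field \<Rightarrow> 'a::ab_group_add \<Rightarrow> 'a) \<Rightarrow> ('k, ('k, 'a) six_tensors) module" where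
  "six_tensor_algebra sA = tensor_algebra (copies_scale sA)"

definition six_gen ::
  "('k::field \<Rightarrow> 'a::ab_group_add \<Rightarrow> 'a) \<Rightarrow> copy \<Rightarrow> 'a \<Rightarrow> ('k, 'a) six_tensors" where
  "six_gen sA i a = tensor_incl (copies_scale sA) (in_copy i a)"

text \<open>The defining relations, as pairs (left-hand side, right-hand side).\<close>

definition UA_relations ::
  "('k::field \<Rightarrow> 'a::ab_group_add \<Rightarrow> 'a) \<Rightarrow> (tri \<Rightarrow> 'a \<Rightarrow> 'a \<Rightarrow> 'a) \<Rightarrow>
   (('k, 'a) six_tensors \<times> ('k, 'a) six_tensors) set" where
  "UA_relations sA dot =
    (let mul = (\<lambda>u v. u \<otimes>\<^bsub>six_tensor_algebra sA\<^esub> v);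
         al = six_gen sA (Alpha Lft); ar = six_gen sA (Alpha Rgt); am = six_gen sA (Alpha Mid);
         bl = six_gen sA (Beta Lft);  br = six_gen sA (Beta Rgt);  bm = six_gen sA (Beta Mid)
     in \<Union>a b.
      {(mul (bl b) (bl a), bl (dot Lft a b)),
       (mul (bl b) (bl a), bl (dot Mid a b)),
       (mul (bl b) (bl a), bl (dot Rgt a b)),

       (mul (bl b) (al a), mul (al a) (bl b)),
       (mul (bl b) (al a), mul (al a) (bm b)),
       (mul (bl b) (al a), mul (al a) (br b)),

       (al (dot Lft a b), mul (al a) (al b)),
       (al (dot Lft a b), mul (al a) (am b)),
       (al (dot Lft a b), mul (al a) (ar b)),

       (br (dot Rgt a b), mul (br b) (br a)),
       (br (dot Rgt a b), mul (br b) (bl a)),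
       (br (dot Rgt a b), mul (br b) (bm a)),

       (mul (ar a) (br b), mul (br b) (ar a)),
       (mul (ar a) (br b), mul (br b) (al a)),
       (mul (ar a) (br b), mul (br b) (am a)),

       (mul (ar a) (ar b), ar (dot Rgt a b)),
       (mul (ar a) (ar b), ar (dot Lft a b)),
       (mul (ar a) (ar b), ar (dot Mid a b)),

       (mul (bl b) (br a), br (dot Lft a b)),
       (mul (bl b) (ar a), mul (ar a) (bl b)),
       (al (dot Rgt a b), mul (ar a) (al b)),

       (mul (bl b) (bm a), bm (dot Lft a b)),
       (mul (bl b) (am a), mul (am a) (bl b)),
       (al (dot Mid a b), mul (am a) (al b)),

       (mul (bm b) (bl a), bm (dot Rgt a b)),
       (mul (bm b) (al a), mul (am a) (br b)),
       (am (dot Lft a b), mul (am a) (ar b)),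

       (mul (bm b) (br a), br (dot Mid a b)),
       (mul (bm b) (ar a), mul (ar a) (bm b)),
       (am (dot Rgt a b), mul (ar a) (am b)),

       (mul (bm b) (bm a), bm (dot Mid a b)),
       (mul (bm b) (am a), mul (am a) (bm b)),
       (am (dot Mid a b), mul (am a) (am b))})"

definition UA_ideal ::
  "('k::field \<Rightarrow> 'a::ab_group_add \<Rightarrow> 'a) \<Rightarrow> (tri \<Rightarrow> 'a \<Rightarrow> 'a \<Rightarrow> 'a) \<Rightarrow>
   ('k, 'a) six_tensors set" where
  "UA_ideal sA dot = Idl\<^bsub>six_tensor_algebra sA\<^esub>
     {u \<ominus>\<^bsub>six_tensor_algebra sA\<^esub> v | u v. (u, v) \<in> UA_relations sA dot}"

definition UA ::
  "('k::field \<Rightarrow> 'a::ab_group_add \<Rightarrow> 'a) \<Rightarrow> (tri \<Rightarrow> 'a \<Rightarrow> 'a \<Rightarrow> 'a) \<Rightarrow>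
   ('k, ('k, 'a) six_tensors set) module" where
  "UA sA dot = quotient_algebra (six_tensor_algebra sA) (UA_ideal sA dot)"

definition UA_gen ::
  "('k::field \<Rightarrow> 'a::ab_group_add \<Rightarrow> 'a) \<Rightarrow> (tri \<Rightarrow> 'a \<Rightarrow> 'a \<Rightarrow> 'a) \<Rightarrow>
   copy \<Rightarrow> 'a \<Rightarrow> ('k, 'a) six_tensors set" where
  "UA_gen sA dot i a = UA_ideal sA dot +>\<^bsub>six_tensor_algebra sA\<^esub> six_gen sA i a"


section \<open>Left modules and the correspondence\<close>

text \<open>
  Left module structures over a (not necessarily commutative) unital \<open>K\<close>-algebra \<open>R\<close> on a given
  \<open>K\<close>-vector space. An action only matters on the carrier of \<open>R\<close>; extensionality makes equal
  structures equal as functions. (The locale \<^locale>\<open>module\<close> of HOL-Algebra is restricted to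
  commutative rings.)
\<close>

definition is_left_module ::
  "('k::field, 'r) module \<Rightarrow> ('k \<Rightarrow> 'm::ab_group_add \<Rightarrow> 'm) \<Rightarrow> ('r \<Rightarrow> 'm \<Rightarrow> 'm) \<Rightarrow> bool" where
  "is_left_module R sM act \<longleftrightarrow>
     act \<in> extensional (carrier R) \<and>
     (\<forall>u \<in> carrier R. Vector_Spaces.linear sM sM (act u)) \<and>
     (\<forall>u \<in> carrier R. \<forall>v \<in> carrier R. \<forall>m. act (u \<oplus>\<^bsub>R\<^esub> v) m = act u m + act v m) \<and>
     (\<forall>c. \<forall>u \<in> carrier R. \<forall>m. act (c \<odot>\<^bsub>R\<^esub> u) m = sM c (act u m)) \<and>
     (\<forall>u \<in> carrier R. \<forall>v \<in> carrier R. \<forall>m. act (u \<otimes>\<^bsub>R\<^esub> v) m = act u (act v m)) \<and>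
     (\<forall>m. act \<one>\<^bsub>R\<^esub> m = m)"

text \<open>
  The operations induced by a module structure: \<open>\<alpha>\<^sub>p(a)\<close> acts as the left operation
  \<open>m \<mapsto> a p m\<close> and \<open>\<beta>\<^sub>p(a)\<close> as the right operation \<open>m \<mapsto> m p a\<close>.
\<close>

definition representation_of_module ::
  "('k::field \<Rightarrow> 'a::ab_group_add \<Rightarrow> 'a) \<Rightarrow> (tri \<Rightarrow> 'a \<Rightarrow> 'a \<Rightarrow> 'a) \<Rightarrow>
   (('k, 'a) six_tensors set \<Rightarrow> 'm \<Rightarrow> 'm) \<Rightarrow>
   (tri \<Rightarrow> 'a \<Rightarrow> 'm \<Rightarrow> 'm) \<times> (tri \<Rightarrow> 'm \<Rightarrow> 'a \<Rightarrow> 'm)" where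
  "representation_of_module sA dot act =
     (\<lambda>p a m. act (UA_gen sA dot (Alpha p) a) m,
      \<lambda>p m a. act (UA_gen sA dot (Beta p) a) m)"

end

theory Submission
  imports Defs
begin

text \<open>
  Every stage of the construction of \<open>UA\<close> has a universal property for modules: a module over the free
  algebra is a family of linear maps indexed by the indeterminates, and a module over \<open>R / (S)\<close> is
  an \<open>R\<close>-module on which \<open>S\<close> acts by zero, because the annihilator of a module is a two-sided
  ideal. Hence a \<open>UA\<close>-module is a bilinear action of the six copies of \<open>A\<close>, i.e. six bilinear
  operations, that respects the 33 relations; these say exactly that each of the 11 laws holds with the
  element of \<open>M\<close> in each of the three positions.
\<close>

section \<open>Modules over quotient algebras\<close>

lemma left_moduleD:
  assumes "is_left_module R sM act"
  shows "act \<in> extensional (carrier R)"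
    and "u \<in> carrier R \<Longrightarrow> Vector_Spaces.linear sM sM (act u)"
    and "u \<in> carrier R \<Longrightarrow> v \<in> carrier R \<Longrightarrow> act (u \<oplus>\<^bsub>R\<^esub> v) m = act u m + act v m"
    and "u \<in> carrier R \<Longrightarrow> act (c \<odot>\<^bsub>R\<^esub> u) m = sM c (act u m)"
    and "u \<in> carrier R \<Longrightarrow> v \<in> carrier R \<Longrightarrow> act (u \<otimes>\<^bsub>R\<^esub> v) m = act u (act v m)"
    and "act \<one>\<^bsub>R\<^esub> m = m"
  using assms unfolding is_left_module_def by blast+

lemma linear_plus: "Vector_Spaces.linear s t f \<Longrightarrow> f (x + y) = f x + f y"
  and linear_scaled: "Vector_Spaces.linear s t f \<Longrightarrow> f (s c x) = t c (f x)"
  by (simp_all add: Vector_Spaces.linear_iff)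

lemma linear_zero: "Vector_Spaces.linear s t f \<Longrightarrow> f 0 = 0"
  using linear_plus[of s t f 0 0] by simp

text \<open>
  A fragment of the axioms of a unital algebra: scalars act through the elements \<open>c \<odot> \<one>\<close>, which
  makes every ideal closed under scalar multiplication.
\<close>

locale scalar_ring = ring R for R :: "('k::field, 'r) module" (structure) +
  assumes smult_closed: "x \<in> carrier R \<Longrightarrow> c \<odot> x \<in> carrier R"
    and smult_assoc: "x \<in> carrier R \<Longrightarrow> y \<in> carrier R \<Longrightarrow> (c \<odot> x) \<otimes> y = c \<odot> (x \<otimes> y)"
begin

lemma smult_eq_mult: "x \<in> carrier R \<Longrightarrow> c \<odot> x = (c \<odot> \<one>) \<otimes> x"
  by (simp add: smult_assoc)

lemma left_module_zero:
  assumes "is_left_module R sM act"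
  shows "act \<zero> m = 0"
  using left_moduleD(3)[OF assms, of \<zero> \<zero> m] by simp

lemma left_module_minus:
  assumes "is_left_module R sM act" "u \<in> carrier R" "v \<in> carrier R"
  shows "act (u \<ominus> v) m = act u m - act v m"
proof -
  have "act u m = act ((u \<ominus> v) \<oplus> v) m"
    using assms(2,3) by (simp add: minus_eq a_assoc l_neg)
  also have "\<dots> = act (u \<ominus> v) m + act v m"
    using assms by (simp add: left_moduleD(3))
  finally show ?thesis by simp
qed

text \<open>In a product with one annihilating factor, a right-hand one sends \<open>m\<close> to 0,
  which the other factor fixes by linearity; a left-hand one kills whatever the other factor
  produced. This is what carries relations from a generating set to the whole ideal.\<close>

lemma annihilator_ideal:
  assumes "is_left_module R sM act"
  shows "ideal {x \<in> carrier R. \<forall>m. act x m = 0} R"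
proof (rule idealI)
  note act = left_moduleD[OF assms]
  show "ring R" by (rule ring_axioms)
  show "subgroup {x \<in> carrier R. \<forall>m. act x m = 0} (add_monoid R)"
  proof (rule add.subgroupI)
    fix x assume "x \<in> {x \<in> carrier R. \<forall>m. act x m = 0}"
    then show "\<ominus> x \<in> {x \<in> carrier R. \<forall>m. act x m = 0}"
      using left_module_minus[OF assms, of \<zero> x] left_module_zero[OF assms]
      by (simp add: minus_eq)
  qed (use act left_module_zero[OF assms] in auto)
  show "x \<otimes> a \<in> {x \<in> carrier R. \<forall>m. act x m = 0}"
    if "a \<in> {x \<in> carrier R. \<forall>m. act x m = 0}" "x \<in> carrier R" for a x
    using that act by (auto intro: linear_zero)
  show "a \<otimes> x \<in> {x \<in> carrier R. \<forall>m. act x m = 0}"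
    if "a \<in> {x \<in> carrier R. \<forall>m. act x m = 0}" "x \<in> carrier R" for a x
    using that act by auto
qed

section \<open>Quotient algebras computed on coset representatives\<close>

lemma quotient_carrier: "carrier (quotient_algebra R I) = (+>) I ` carrier R"
  by (auto simp: quotient_algebra_def ring.extend_def module.fields_def FactRing_def A_RCOSETS_def')

context
  fixes I assumes I: "ideal I R"
begin

interpretation ideal I R by (rule I)

lemma quotient_add:
  "x \<in> carrier R \<Longrightarrow> y \<in> carrier R \<Longrightarrow>
    (I +> x) \<oplus>\<^bsub>quotient_algebra R I\<^esub> (I +> y) = I +> (x \<oplus> y)"
  by (simp add: quotient_algebra_def ring.extend_def module.fields_def FactRing_def a_rcos_sum)

lemma quotient_mult:
  "x \<in> carrier R \<Longrightarrow> y \<in> carrier R \<Longrightarrow>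
    (I +> x) \<otimes>\<^bsub>quotient_algebra R I\<^esub> (I +> y) = I +> (x \<otimes> y)"
  by (simp add: quotient_algebra_def ring.extend_def module.fields_def FactRing_def rcoset_mult_add)

lemma quotient_one: "\<one>\<^bsub>quotient_algebra R I\<^esub> = I +> \<one>"
  by (simp add: quotient_algebra_def ring.extend_def module.fields_def FactRing_def)

lemma coset_eq_iff:
  assumes "x \<in> carrier R" "y \<in> carrier R"
  shows "I +> x = I +> y \<longleftrightarrow> x \<ominus> y \<in> I"
  using assms quotient_eq_iff_same_a_r_cos[OF I] by simp

text \<open>The scalar multiple of a coset is defined as a union over all its representatives, so
  these must all give the same coset. Two of them differ by an element of \<open>I\<close>, and
  scaling that difference is left multiplication by \<open>c \<odot> \<one>\<close>, which stays in
  \<open>I\<close>.\<close>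

lemma quotient_smult:
  assumes "x \<in> carrier R"
  shows "c \<odot>\<^bsub>quotient_algebra R I\<^esub> (I +> x) = I +> (c \<odot> x)"
proof -
  have "I +> (c \<odot> y) = I +> (c \<odot> x)" if "y \<in> I +> x" for y
  proof -
    note c = smult_closed[of \<one> c, OF one_closed]
    have y: "y \<in> carrier R" using a_r_coset_subset_G[OF a_subset assms] that by blast
    have "I +> y = I +> x" using a_repr_independence'[OF that assms] by simp
    then have "y \<ominus> x \<in> I" using y assms coset_eq_iff by blast
    then have "(c \<odot> \<one>) \<otimes> (y \<ominus> x) \<in> I" using c by (rule I_l_closed)
    moreover have "c \<odot> y \<ominus> c \<odot> x = (c \<odot> \<one>) \<otimes> (y \<ominus> x)"
      unfolding smult_eq_mult[OF y, of c] smult_eq_mult[OF assms, of c]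
      using y assms c by (simp add: minus_eq r_distr r_minus)
    ultimately show ?thesis
      using y assms coset_eq_iff smult_closed by metis
  qed
  moreover have "x \<in> I +> x" using assms a_rcos_self by blast
  ultimately have "(\<Union>y\<in>I +> x. I +> (c \<odot> y)) = I +> (c \<odot> x)"
    by (intro SUP_eq_const) blast+
  then show ?thesis
    by (simp add: quotient_algebra_def ring.extend_def module.fields_def)
qed

text \<open>This makes the quotient construction iterable: the enveloping algebra is a quotient of
  the tensor algebra, itself a quotient.\<close>

lemma quotient_scalar_ring: "scalar_ring (quotient_algebra R I)"
proof -
  interpret Q: ring "quotient_algebra R I"
    \<comment> \<open>The quotient algebra adds only a scalar multiplication to
      \<open>R Quot I\<close>. The two records have different types, so the ring axioms are
      transferred by unfolding them to statements about the common fields.\<close>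
    using quotient_is_ring
    by (simp (no_asm_use) add: quotient_algebra_def ring.extend_def module.fields_def FactRing_def
        ring_def ring_axioms_def abelian_group_def abelian_group_axioms_def abelian_monoid_def
        comm_group_def group_def group_axioms_def comm_monoid_def
        comm_monoid_axioms_def monoid_def Units_def)
  show ?thesis
    by unfold_locales
      (auto simp: quotient_carrier quotient_smult quotient_mult smult_closed smult_assoc)
qed

text \<open>Restriction of scalars along the projection; cutting the function down to the carrier
  restores extensionality.\<close>

lemma left_module_pullback:
  assumes "is_left_module (quotient_algebra R I) sM act"
  shows "is_left_module R sM (\<lambda>x\<in>carrier R. act (I +> x))"
proof -
  note act = left_moduleD[OF assms, unfolded quotient_carrier]
  show ?thesis
    using act(2) act(3)[OF imageI imageI] act(4)[OF imageI] act(5)[OF imageI imageI] act(6)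
    by (simp add: is_left_module_def smult_closed quotient_add quotient_mult quotient_smult quotient_one)
qed

text \<open>A coset acts through an arbitrarily chosen representative. Representatives differ by an
  element of \<open>I\<close>, which acts by zero, so the choice does not matter.\<close>

lemma left_module_descend:
  assumes "is_left_module R sM act" "\<And>x m. x \<in> I \<Longrightarrow> act x m = 0"
  obtains act' where "is_left_module (quotient_algebra R I) sM act'"
    "\<And>x. x \<in> carrier R \<Longrightarrow> act' (I +> x) = act x"
proof
  define act' where
    "act' = (\<lambda>X\<in>carrier (quotient_algebra R I). act (SOME x. x \<in> carrier R \<and> X = I +> x))"
  show eq: "act' (I +> x) = act x" if x: "x \<in> carrier R" for x
  proof -
    define y where "y = (SOME y. y \<in> carrier R \<and> I +> x = I +> y)"
    have y: "y \<in> carrier R" "I +> x = I +> y"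
      using someI_ex[of "\<lambda>y. y \<in> carrier R \<and> I +> x = I +> y"] x unfolding y_def by blast+
    then have "act (x \<ominus> y) m = 0" for m
      using assms(2) coset_eq_iff x by blast
    then have "act x = act y"
      using left_module_minus[OF assms(1) x y(1)] by (simp add: fun_eq_iff)
    then show ?thesis
      using x by (simp add: act'_def quotient_carrier y_def)
  qed
  have "act' \<in> extensional (carrier (quotient_algebra R I))"
    by (simp add: act'_def)
  then show "is_left_module (quotient_algebra R I) sM act'"
    using left_moduleD[OF assms(1)]
    by (auto simp: is_left_module_def quotient_carrier quotient_add quotient_mult quotient_smult
        quotient_one eq smult_closed)
qed

end

text \<open>Injectivity: every element of the quotient is a coset, so the pullback fixes the action
  there, and extensionality fixes it elsewhere. Surjectivity: the annihilator is an ideal containing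
  \<open>S\<close>, hence contains \<open>Idl S\<close>, and the action descends.\<close>

theorem left_modules_of_quotient:
  assumes "S \<subseteq> carrier R"
  shows "bij_betw (\<lambda>act. \<lambda>x\<in>carrier R. act (Idl S +> x))
    {act. is_left_module (quotient_algebra R (Idl S)) sM act}
    {act. is_left_module R sM act \<and> (\<forall>x\<in>S. \<forall>m. act x m = 0)}"
    (is "bij_betw ?pull ?Q ?M")
proof -
  have I: "ideal (Idl S) R" using assms by (rule genideal_ideal)
  interpret ideal "Idl S" R by (rule I)
  show ?thesis
  proof (rule bij_betw_imageI)
    show "inj_on ?pull ?Q"
    proof (rule inj_onI)
      fix act act'
      assume *: "act \<in> ?Q" "act' \<in> ?Q" "?pull act = ?pull act'"
      show "act = act'"
      proof (rule extensionalityI)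
        show "act \<in> extensional (carrier (quotient_algebra R (Idl S)))"
          "act' \<in> extensional (carrier (quotient_algebra R (Idl S)))"
          using * by (simp_all add: left_moduleD(1))
        fix X assume "X \<in> carrier (quotient_algebra R (Idl S))"
        then obtain x where "x \<in> carrier R" "X = Idl S +> x" by (auto simp: quotient_carrier)
        then show "act X = act' X" using fun_cong[OF *(3), of x] by simp
      qed
    qed
    show "?pull ` ?Q = ?M"
    proof (intro equalityI subsetI)
      fix act assume "act \<in> ?pull ` ?Q"
      then obtain act' where act': "is_left_module (quotient_algebra R (Idl S)) sM act'"
        and act: "act = ?pull act'" by blast
      have "act x m = 0" if "x \<in> S" for x m
      proof -
        have x: "x \<in> carrier R" "x \<in> Idl S" using that assms genideal_self by blast+
        then have "Idl S +> x = Idl S +> \<zero>"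
          using coset_eq_iff[OF I] by (simp add: minus_eq)
        then have "act x m = act \<zero> m" using x by (simp add: act)
        then show ?thesis
          using left_module_zero[OF left_module_pullback[OF I act'], of m] by (simp add: act)
      qed
      then show "act \<in> ?M" using left_module_pullback[OF I act'] by (simp add: act)
    next
      fix act assume act: "act \<in> ?M"
      then have "Idl S \<subseteq> {x \<in> carrier R. \<forall>m. act x m = 0}"
        using assms by (intro genideal_minimal annihilator_ideal) auto
      then obtain act' where act': "is_left_module (quotient_algebra R (Idl S)) sM act'"
        "\<And>x. x \<in> carrier R \<Longrightarrow> act' (Idl S +> x) = act x"
        using left_module_descend[OF I, of sM act] act by blast
      have "act \<in> extensional (carrier R)" using act left_moduleD(1) by blast
      then have "?pull act' = act"
        by (intro ext) (auto simp: act'(2) extensional_def)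
      then show "act \<in> ?pull ` ?Q" using act'(1) by blast
    qed
  qed
qed

end

section \<open>Modules over free algebras and tensor algebras\<close>

lemma poly_mapping_induct [case_names single plus]:
  fixes p :: "'a \<Rightarrow>\<^sub>0 'b::comm_monoid_add"
  assumes single: "\<And>k c. P (Poly_Mapping.single k c)"
    and plus: "\<And>p q. P p \<Longrightarrow> P q \<Longrightarrow> P (p + q)"
  shows "P p"
proof (induction p rule: update_induct)
  case const
  \<comment> \<open>The zero mapping is a single term with coefficient 0 at an arbitrary key, so the
    induction rule can do without a case for zero.\<close>
  show ?case using single[of undefined 0] by simp
next
  case (update p k c)
  \<comment> \<open>The key is fresh for \<open>p\<close>, so overwriting its value amounts to
    adding a term.\<close>
  have "Poly_Mapping.update k c p = p + Poly_Mapping.single k c"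
    using update(1) by (intro poly_mapping_eqI)
      (auto simp: lookup_add lookup_single lookup_update when_def in_keys_iff)
  then show ?case using update(3) single plus by simp
qed

lemma free_algebra_simps [simp]:
  "carrier free_algebra = UNIV"
  "p \<oplus>\<^bsub>free_algebra\<^esub> q = p + q"
  "p \<otimes>\<^bsub>free_algebra\<^esub> q = p * q"
  "\<one>\<^bsub>free_algebra\<^esub> = 1"
  "\<zero>\<^bsub>free_algebra\<^esub> = 0"
  "c \<odot>\<^bsub>free_algebra\<^esub> p = Poly_Mapping.map ((*) c) p"
  by (simp_all add: free_algebra_def)

lemma ring_free_algebra: "ring (free_algebra :: ('k::field, 'v free_monoid \<Rightarrow>\<^sub>0 'k) module)"
proof (rule ringI)
  show "abelian_group (free_algebra :: ('k, 'v free_monoid \<Rightarrow>\<^sub>0 'k) module)"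
  proof (rule abelian_groupI)
    fix x :: "'v free_monoid \<Rightarrow>\<^sub>0 'k"
    show "\<exists>y\<in>carrier free_algebra. y \<oplus>\<^bsub>free_algebra\<^esub> x = \<zero>\<^bsub>free_algebra\<^esub>"
      by (rule bexI[of _ "- x"]) simp_all
  qed (simp_all add: add_ac)
  show "Group.monoid (free_algebra :: ('k, 'v free_monoid \<Rightarrow>\<^sub>0 'k) module)"
    by (rule monoidI) (simp_all add: mult.assoc)
qed (simp_all add: algebra_simps)

global_interpretation free_algebra: scalar_ring "free_algebra :: ('k::field, 'v free_monoid \<Rightarrow>\<^sub>0 'k) module"
  by (intro scalar_ring.intro ring_free_algebra scalar_ring_axioms.intro)
    (simp_all add: mult_map_scale_conv_mult mult.assoc)

lemma free_algebra_minus [simp]: "p \<ominus>\<^bsub>free_algebra\<^esub> q = p - q"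
proof -
  have "\<ominus>\<^bsub>free_algebra\<^esub> q = - q"
    by (rule free_algebra.minus_equality) simp_all
  then show ?thesis by (simp add: a_minus_def)
qed

text \<open>The rightmost letter acts first, as a left module requires, so concatenation of words
  becomes composition.\<close>

definition word_action :: "('v \<Rightarrow> 'm \<Rightarrow> 'm) \<Rightarrow> 'v free_monoid \<Rightarrow> 'm \<Rightarrow> 'm" where
  "word_action g w = (case w of Letters xs \<Rightarrow> foldr g xs)"

lemma word_action_simps [simp]:
  "word_action g 0 m = m"
  "word_action g (Letters []) m = m"
  "word_action g (Letters (x # xs)) m = g x (word_action g (Letters xs) m)"
  by (simp_all add: word_action_def zero_free_monoid_def)

lemma word_action_plus: "word_action g (v + w) m = word_action g v (word_action g w m)"
  by (cases v; cases w) (simp add: word_action_def)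

text \<open>The linear extension of the word action, which serves as the inverse of restricting an
  action to the indeterminates.\<close>

definition free_action ::
  "('k::field \<Rightarrow> 'm::ab_group_add \<Rightarrow> 'm) \<Rightarrow> ('v \<Rightarrow> 'm \<Rightarrow> 'm) \<Rightarrow> ('v free_monoid \<Rightarrow>\<^sub>0 'k) \<Rightarrow> 'm \<Rightarrow> 'm" where
  "free_action sM g p m =
     (\<Sum>w\<in>Poly_Mapping.keys p. sM (Poly_Mapping.lookup p w) (word_action g w m))"

context
  fixes sM :: "'k::field \<Rightarrow> 'm::ab_group_add \<Rightarrow> 'm"
  assumes vector_space_sM: "vector_space sM"
begin

interpretation M: vector_space sM by (rule vector_space_sM)

text \<open>Words outside the support have coefficient 0. Enlarging the index set lets
  \<open>p\<close>, \<open>q\<close> and \<open>p + q\<close> be summed over the same words.\<close>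

lemma free_action_superset:
  assumes "finite W" "Poly_Mapping.keys p \<subseteq> W"
  shows "free_action sM g p m = (\<Sum>w\<in>W. sM (Poly_Mapping.lookup p w) (word_action g w m))"
  unfolding free_action_def
  by (rule sum.mono_neutral_left) (use assms in \<open>auto simp: in_keys_iff\<close>)

lemma free_action_single:
  "free_action sM g (Poly_Mapping.single w c) m = sM c (word_action g w m)"
  by (subst free_action_superset[of "{w}"]) auto

lemma free_action_plus:
  "free_action sM g (p + q) m = free_action sM g p m + free_action sM g q m"
  using keys_add[of p q]
  by (simp add: free_action_superset[of "Poly_Mapping.keys p \<union> Poly_Mapping.keys q"]
      lookup_add M.scale_left_distrib sum.distrib)

context
  fixes g :: "'v \<Rightarrow> 'm \<Rightarrow> 'm"
  assumes linear_g: "\<And>v. Vector_Spaces.linear sM sM (g v)"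
begin

lemma linear_word_action: "Vector_Spaces.linear sM sM (word_action g w)"
proof (cases w)
  case (Letters xs)
  have "Vector_Spaces.linear sM sM (word_action g (Letters xs))"
    using linear_g by (induction xs) (simp_all add: Vector_Spaces.linear_iff)
  then show ?thesis using Letters by simp
qed

lemma linear_free_action: "Vector_Spaces.linear sM sM (free_action sM g p)"
proof (induction p rule: poly_mapping_induct)
  case (single w c)
  then show ?case
    using linear_word_action[of w]
    by (simp add: Vector_Spaces.linear_iff free_action_single M.scale_right_distrib M.scale_left_commute)
next
  case (plus p q)
  then show ?case
    by (simp add: Vector_Spaces.linear_iff free_action_plus M.scale_right_distrib)
qed

text \<open>Both sides are additive in \<open>p\<close> and in \<open>q\<close>, so single terms
  suffice. There concatenation of words is composition, and linearity of the word action moves the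
  inner coefficient outside.\<close>

lemma free_action_mult: "free_action sM g (p * q) m = free_action sM g p (free_action sM g q m)"
proof (induction p rule: poly_mapping_induct)
  case (single v c)
  show ?case
  proof (induction q rule: poly_mapping_induct)
    case (single w d)
    show ?case
      by (simp add: mult_single free_action_single word_action_plus
          linear_scaled[OF linear_word_action])
  next
    case (plus p q)
    then show ?case
      by (simp add: distrib_left free_action_plus linear_plus[OF linear_free_action])
  qed
next
  case (plus p q)
  then show ?case by (simp add: distrib_right free_action_plus)
qed

lemma left_module_free_action: "is_left_module free_algebra sM (free_action sM g)"
proof -
  have "free_action sM g 1 m = m" for m
    using free_action_single[of g 0 1 m] by simp
  then show ?thesis
    by (simp add: is_left_module_def extensional_def linear_free_action free_action_plus
        free_action_mult mult_map_scale_conv_mult free_action_single)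
qed

end

text \<open>An action is determined by its values on the indeterminates, because words are products
  of indeterminates and polynomials are linear combinations of words.\<close>

lemma free_action_unique:
  assumes "is_left_module free_algebra sM act"
  shows "free_action sM (\<lambda>v. act (indet v)) p m = act p m"
proof (induction p arbitrary: m rule: poly_mapping_induct)
  case (single w c)
  note act = left_moduleD[OF assms, simplified]
  have "word_action (\<lambda>v. act (indet v)) (Letters xs) m = act (Poly_Mapping.single (Letters xs) 1) m" for xs
  proof (induction xs)
    case Nil
    \<comment> \<open>The empty word is the neutral element of the additive monoid of words, so its
      single term is the unit of the algebra.\<close>
    have "Poly_Mapping.single (Letters []) 1 = (1 :: 'a free_monoid \<Rightarrow>\<^sub>0 'k)"
      unfolding zero_free_monoid_def[symmetric] by simp
    then show ?case using act(6) by simp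
  next
    case (Cons x xs)
    have "Poly_Mapping.single (Letters (x # xs)) 1 = (indet x * Poly_Mapping.single (Letters xs) 1 :: 'a free_monoid \<Rightarrow>\<^sub>0 'k)"
      by (simp add: indet_def mult_single)
    then show ?case using Cons act(5) by simp
  qed
  then have "word_action (\<lambda>v. act (indet v)) w m = act (Poly_Mapping.single w 1) m"
    by (cases w) simp
  then have "free_action sM (\<lambda>v. act (indet v)) (Poly_Mapping.single w c) m
      = act (Poly_Mapping.map ((*) c) (Poly_Mapping.single w 1)) m"
    using left_moduleD(4)[OF assms, of "Poly_Mapping.single w 1" c m]
    by (simp add: free_action_single)
  then show ?case by simp
next
  case (plus p q)
  then show ?case
    using left_moduleD(3)[OF assms] by (simp add: free_action_plus)
qed

theorem left_modules_of_free_algebra: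
  "bij_betw (\<lambda>act v. act (indet v))
    {act :: ('v free_monoid \<Rightarrow>\<^sub>0 'k) \<Rightarrow> 'm \<Rightarrow> 'm. is_left_module free_algebra sM act}
    {g. \<forall>v. Vector_Spaces.linear sM sM (g v)}"
  by (rule bij_betw_byWitness[of _ "free_action sM"])
    (auto simp: free_action_unique left_module_free_action left_moduleD(2) fun_eq_iff
      free_action_single[of _ "Letters [_]" 1, folded indet_def])

end

section \<open>Modules over the tensor algebra\<close>

definition linearity_relations ::
  "('k::field \<Rightarrow> 'v::ab_group_add \<Rightarrow> 'v) \<Rightarrow> ('v free_monoid \<Rightarrow>\<^sub>0 'k) set" where
  "linearity_relations sV =
     {indet (v + w) - (indet v + indet w) | v w. True} \<union>
     {indet (sV c v) - Poly_Mapping.map ((*) c) (indet v) | c v. True}"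

lemma linearity_ideal_eq: "linearity_ideal sV = Idl\<^bsub>free_algebra\<^esub> (linearity_relations sV)"
  by (simp add: linearity_ideal_def linearity_relations_def)

lemma ideal_linearity_ideal:
  "ideal (linearity_ideal sV) (free_algebra :: ('k::field, 'v::ab_group_add free_monoid \<Rightarrow>\<^sub>0 'k) module)"
  unfolding linearity_ideal_eq by (rule free_algebra.genideal_ideal) simp

lemma scalar_ring_tensor_algebra: "scalar_ring (tensor_algebra sV)"
  unfolding tensor_algebra_def
  by (rule free_algebra.quotient_scalar_ring[OF ideal_linearity_ideal])

lemma tensor_incl_carrier: "tensor_incl sV v \<in> carrier (tensor_algebra sV)"
  by (simp add: tensor_algebra_def tensor_incl_def free_algebra.quotient_carrier)

text \<open>A difference acts by zero exactly when its two sides act alike; the two families of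
  relations thus express additivity and homogeneity in \<open>v\<close>.\<close>

lemma kills_linearity_relations_iff:
  assumes "vector_space sV" "vector_space sM" "is_left_module free_algebra sM act"
  shows "(\<forall>x\<in>linearity_relations sV. \<forall>m. act x m = 0) \<longleftrightarrow>
    (\<forall>m. Vector_Spaces.linear sV sM (\<lambda>v. act (indet v) m))"
proof -
  note minus = free_algebra.left_module_minus[OF assms(3), simplified]
  have "(\<forall>x\<in>linearity_relations sV. \<forall>m. act x m = 0) \<longleftrightarrow>
    (\<forall>v w m. act (indet (v + w) - (indet v + indet w)) m = 0) \<and>
    (\<forall>c v m. act (indet (sV c v) - Poly_Mapping.map ((*) c) (indet v)) m = 0)"
    unfolding linearity_relations_def by blast
  also have "\<dots> \<longleftrightarrow> (\<forall>m. Vector_Spaces.linear sV sM (\<lambda>v. act (indet v) m))"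
    using assms(1,2) left_moduleD(3,4)[OF assms(3)]
    by (auto simp: Vector_Spaces.linear_iff minus)
  finally show ?thesis .
qed

text \<open>Linearity in \<open>m\<close> comes from the modules over the free algebra, linearity in
  \<open>v\<close> from passing to the quotient; together they are bilinearity.\<close>

theorem left_modules_of_tensor_algebra:
  assumes "vector_space sV" "vector_space sM"
  shows "bij_betw (\<lambda>act v. act (tensor_incl sV v))
    {act. is_left_module (tensor_algebra sV) sM act} {g. bilinear_map sV sM sM g}"
proof -
  have "bij_betw ((\<lambda>act v. act (indet v)) \<circ>
      (\<lambda>act. \<lambda>x\<in>carrier free_algebra. act (linearity_ideal sV +>\<^bsub>free_algebra\<^esub> x)))
    {act. is_left_module (tensor_algebra sV) sM act}
    {g \<in> {g. \<forall>v. Vector_Spaces.linear sM sM (g v)}. \<forall>m. Vector_Spaces.linear sV sM (\<lambda>v. g v m)}"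
  proof (rule bij_betw_trans)
    show "bij_betw (\<lambda>act. \<lambda>x\<in>carrier free_algebra. act (linearity_ideal sV +>\<^bsub>free_algebra\<^esub> x))
      {act. is_left_module (tensor_algebra sV) sM act}
      {act \<in> {act. is_left_module free_algebra sM act}. \<forall>x\<in>linearity_relations sV. \<forall>m. act x m = 0}"
      using free_algebra.left_modules_of_quotient[of "linearity_relations sV" sM]
      by (simp add: tensor_algebra_def linearity_ideal_eq)
    show "bij_betw (\<lambda>act v. act (indet v))
      {act \<in> {act. is_left_module free_algebra sM act}. \<forall>x\<in>linearity_relations sV. \<forall>m. act x m = 0}
      {g \<in> {g. \<forall>v. Vector_Spaces.linear sM sM (g v)}. \<forall>m. Vector_Spaces.linear sV sM (\<lambda>v. g v m)}"
      using kills_linearity_relations_iff[OF assms]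
      by (intro bij_betw_Collect[OF left_modules_of_free_algebra[OF assms(2)]]) auto
  qed
  then show ?thesis
    by (simp add: comp_def tensor_incl_def bilinear_map_def)
qed

section \<open>Representations as modules over the universal enveloping algebra\<close>

lemma UNIV_copy: "(UNIV :: copy set) =
    {Alpha Lft, Alpha Rgt, Alpha Mid, Beta Lft, Beta Rgt, Beta Mid}"
proof -
  have "i \<in> {Alpha Lft, Alpha Rgt, Alpha Mid, Beta Lft, Beta Rgt, Beta Mid}" for i
    by (cases i; rename_tac p; case_tac p) simp_all
  then show ?thesis by blast
qed

lemma finite_UNIV_copy: "finite (UNIV :: copy set)"
  by (simp add: UNIV_copy)

lemma vector_space_copies_scale: "vector_space sA \<Longrightarrow> vector_space (copies_scale sA)"
  by (simp add: vector_space_def copies_scale_def fun_eq_iff)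

lemma linear_in_copy:
  assumes "vector_space sA"
  shows "Vector_Spaces.linear sA (copies_scale sA) (in_copy i)"
proof -
  interpret vector_space sA by fact
  show ?thesis
    using assms vector_space_copies_scale
    by (auto simp: Vector_Spaces.linear_iff in_copy_def copies_scale_def)
qed

text \<open>The vector \<open>v\<close> is the sum of its components. Truncating it to a finite set
  of copies allows these to be split off one at a time.\<close>

lemma linear_sum_in_copy:
  fixes v :: "copy \<Rightarrow> 'a::ab_group_add"
  assumes "Vector_Spaces.linear (copies_scale sA) sM h"
  shows "h v = (\<Sum>i\<in>UNIV. h (in_copy i (v i)))"
proof -
  have "h (\<lambda>i. if i \<in> I then v i else 0) = (\<Sum>i\<in>I. h (in_copy i (v i)))" if "finite I" for I
    using that
  proof (induction I)
    case empty
    show ?case using linear_zero[OF assms] by (simp add: zero_fun_def)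
  next
    case (insert j I)
    have "(\<lambda>i. if i \<in> insert j I then v i else 0) = in_copy j (v j) + (\<lambda>i. if i \<in> I then v i else 0)"
      using insert(2) by (auto simp: in_copy_def)
    then show ?case using insert by (simp add: linear_plus[OF assms])
  qed
  from this[OF finite_UNIV_copy] show ?thesis by simp
qed

text \<open>The stage of \<open>representation_of_module\<close> that starts from an action of the
  direct sum instead of one of the enveloping algebra.\<close>

definition representation_operations ::
  "((copy \<Rightarrow> 'a::zero) \<Rightarrow> 'm \<Rightarrow> 'm) \<Rightarrow> (tri \<Rightarrow> 'a \<Rightarrow> 'm \<Rightarrow> 'm) \<times> (tri \<Rightarrow> 'm \<Rightarrow> 'a \<Rightarrow> 'm)" where
  "representation_operations g =
     (\<lambda>p a m. g (in_copy (Alpha p) a) m, \<lambda>p m a. g (in_copy (Beta p) a) m)"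

text \<open>Gives left and right operations one common shape, so that the six can be summed over
  \<open>copy\<close>.\<close>

definition copy_action ::
  "(tri \<Rightarrow> 'a \<Rightarrow> 'm \<Rightarrow> 'm) \<times> (tri \<Rightarrow> 'm \<Rightarrow> 'a \<Rightarrow> 'm) \<Rightarrow> copy \<Rightarrow> 'a \<Rightarrow> 'm \<Rightarrow> 'm" where
  "copy_action \<rho> i a m = (case i of Alpha p \<Rightarrow> fst \<rho> p a m | Beta p \<Rightarrow> snd \<rho> p m a)"

lemma representation_operations_bij:
  assumes "vector_space sA" "vector_space sM"
  shows "bij_betw representation_operations {g. bilinear_map (copies_scale sA) sM sM g}
    {(lop, rop). (\<forall>p. bilinear_map sA sM sM (lop p)) \<and> (\<forall>p. bilinear_map sM sA sM (rop p))}"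
    (is "bij_betw _ ?G ?R")
proof (rule bij_betw_byWitness)
  \<comment> \<open>The inverse lets a vector act by the sum of the actions of its six
    components.\<close>
  define rec :: "_ \<Rightarrow> (copy \<Rightarrow> 'b) \<Rightarrow> 'c \<Rightarrow> 'c" where
    "rec = (\<lambda>\<rho> v m. \<Sum>i\<in>UNIV. copy_action \<rho> i (v i) m)"
  interpret M: vector_space sM by fact
  have action: "bilinear_map sA sM sM (copy_action \<rho> i)" if "\<rho> \<in> ?R" for \<rho> i
    using that by (cases i) (auto simp: bilinear_map_def copy_action_def[abs_def])
  show "\<forall>g\<in>?G. rec (representation_operations g) = g"
  proof (intro ballI ext)
    fix g v m assume "g \<in> ?G"
    then have "Vector_Spaces.linear (copies_scale sA) sM (\<lambda>v. g v m)"
      by (simp add: bilinear_map_def)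
    from linear_sum_in_copy[OF this, of v]
    show "rec (representation_operations g) v m = g v m"
      by (simp add: rec_def copy_action_def representation_operations_def split: copy.split)
        (rule sum.cong, auto split: copy.split)
  qed
  show "\<forall>\<rho>\<in>?R. representation_operations (rec \<rho>) = \<rho>"
  proof
    fix \<rho> assume \<rho>: "\<rho> \<in> ?R"
    have "rec \<rho> (in_copy i a) m = copy_action \<rho> i a m" for i a m
    proof -
      \<comment> \<open>All components of \<open>in_copy i a\<close> other than the one at
        \<open>i\<close> are 0 and act by zero, so one summand survives.\<close>
      have "copy_action \<rho> j 0 m = 0" for j
        using linear_zero action[OF \<rho>, of j] by (fastforce simp: bilinear_map_def)
      then have "rec \<rho> (in_copy i a) m = (\<Sum>j\<in>UNIV. if j = i then copy_action \<rho> i a m else 0)"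
        unfolding rec_def by (intro sum.cong) (auto simp: in_copy_def)
      then show ?thesis using finite_UNIV_copy by simp
    qed
    then show "representation_operations (rec \<rho>) = \<rho>"
      by (simp add: representation_operations_def copy_action_def)
  qed
  show "representation_operations ` ?G \<subseteq> ?R"
    using linear_in_copy[OF assms(1)] assms
    by (auto simp: representation_operations_def bilinear_map_def Vector_Spaces.linear_iff)
  show "rec ` ?R \<subseteq> ?G"
  proof (intro image_subsetI CollectI)
    fix \<rho> assume "\<rho> \<in> ?R"
    note action[OF this]
    then show "bilinear_map (copies_scale sA) sM sM (rec \<rho>)"
      using assms vector_space_copies_scale[OF assms(1)]
      by (simp add: bilinear_map_def Vector_Spaces.linear_iff rec_def sum.distrib
          M.scale_sum_right copies_scale_def)
  qed
qed

section \<open>The 33 relations and the 11 laws\<close>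

lemma six_gen_carrier: "six_gen sA i a \<in> carrier (six_tensor_algebra sA)"
  by (simp add: six_gen_def six_tensor_algebra_def tensor_incl_carrier)

text \<open>A product of generators acts by composition, so each relation becomes one law at one
  position of \<open>m\<close>: two \<beta> factors put \<open>m\<close> first, an \<alpha> and a
  \<beta> put it in the middle, two \<alpha> factors put it last.\<close>

lemma kills_UA_relations_iff:
  fixes sA :: "'k::field \<Rightarrow> 'a::ab_group_add \<Rightarrow> 'a"
  assumes act: "is_left_module (six_tensor_algebra sA) sM act"
    and \<rho>: "representation_operations (\<lambda>v. act (tensor_incl (copies_scale sA) v)) = (lop, rop)"
  shows "(\<forall>(u, v)\<in>UA_relations sA dot. \<forall>m. act u m = act v m) \<longleftrightarrow>
    (\<forall>(p, q, r, s) \<in> triassociative_laws. \<forall>a b m.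
        rop q (rop p m a) b = rop r m (dot s a b) \<and>
        rop q (lop p a m) b = lop r a (rop s m b) \<and>
        lop q (dot p a b) m = lop r a (lop s b m))"
proof -
  have gen: "act (six_gen sA (Alpha p) a) m = lop p a m" "act (six_gen sA (Beta p) a) m = rop p m a"
    for p a m
    using \<rho> by (auto simp: representation_operations_def six_gen_def)
  have mul: "act (six_gen sA i a \<otimes>\<^bsub>six_tensor_algebra sA\<^esub> six_gen sA j b) m =
      act (six_gen sA i a) (act (six_gen sA j b) m)" for i a j b m
    by (rule left_moduleD(5)[OF act six_gen_carrier six_gen_carrier])
  show ?thesis
    \<comment> \<open>Nine relations state the right-hand side of their law first; the instances of
      \<open>eq_commute\<close> turn them around, after which both sides are the same conjunction up
      to order.\<close>
    unfolding UA_relations_def triassociative_laws_def Let_def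
    by (simp add: gen mul all_conj_distrib
        eq_commute[of "rop Rgt m (dot Rgt a b)" for a b m]
        eq_commute[of "lop Rgt a (rop Rgt m b)" for a b m]
        eq_commute[of "lop Rgt a (lop Rgt b m)" for a b m])
      (rule iffI; elim conjE; intro conjI; assumption)
qed

lemma UA_relations_carrier:
  assumes "(u, v) \<in> UA_relations sA dot"
  shows "u \<in> carrier (six_tensor_algebra sA)" "v \<in> carrier (six_tensor_algebra sA)"
proof -
  interpret scalar_ring "six_tensor_algebra sA"
    unfolding six_tensor_algebra_def by (rule scalar_ring_tensor_algebra)
  show "u \<in> carrier (six_tensor_algebra sA)" "v \<in> carrier (six_tensor_algebra sA)"
    using assms by (auto simp: UA_relations_def Let_def six_gen_carrier)
qed

theorem proposition3p2:
  fixes scaleA :: "'k::field \<Rightarrow> 'a::ab_group_add \<Rightarrow> 'a"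
    and dot :: "tri \<Rightarrow> 'a \<Rightarrow> 'a \<Rightarrow> 'a"
    and scaleM :: "'k \<Rightarrow> 'm::ab_group_add \<Rightarrow> 'm"
  assumes "triassociative_algebra scaleA dot"
    and "vector_space scaleM"
  shows "bij_betw (representation_of_module scaleA dot)
           {act. is_left_module (UA scaleA dot) scaleM act}
           {\<rho>. is_representation scaleA dot scaleM \<rho>}"
proof -
  let ?T = "six_tensor_algebra scaleA"
  define S where "S = {u \<ominus>\<^bsub>?T\<^esub> v | u v. (u, v) \<in> UA_relations scaleA dot}"
  \<comment> \<open>The equational part of \<open>is_representation\<close>, separated from
    bilinearity because it alone corresponds to the relations imposed on the tensor algebra.\<close>
  define laws where "laws = (\<lambda>(lop, rop). \<forall>(p, q, r, s) \<in> triassociative_laws. \<forall>a b (m::'m).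
        rop q (rop p m a) b = rop r m (dot s a b) \<and>
        rop q (lop p a m) b = lop r a (rop s m b) \<and>
        lop q (dot p a b) m = lop r a (lop s b m))"
  interpret T: scalar_ring ?T
    unfolding six_tensor_algebra_def by (rule scalar_ring_tensor_algebra)
  have A: "vector_space scaleA"
    using assms(1) by (simp add: triassociative_algebra_def)
  have S: "S \<subseteq> carrier ?T"
    unfolding S_def using UA_relations_carrier by (blast intro: T.minus_closed)
  let ?pull = "\<lambda>act. \<lambda>x\<in>carrier ?T. act (UA_ideal scaleA dot +>\<^bsub>?T\<^esub> x)"
  let ?gens = "\<lambda>act. representation_operations (\<lambda>v. act (tensor_incl (copies_scale scaleA) v))"
  let ?R = "{(lop, rop). (\<forall>p. bilinear_map scaleA scaleM scaleM (lop p)) \<and>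
      (\<forall>p. bilinear_map scaleM scaleA scaleM (rop p))}"
  have pull: "bij_betw ?pull {act. is_left_module (UA scaleA dot) scaleM act}
      {act \<in> {act. is_left_module ?T scaleM act}. \<forall>x\<in>S. \<forall>m. act x m = 0}"
    using T.left_modules_of_quotient[OF S, of scaleM]
    by (simp add: UA_def UA_ideal_def S_def)
  \<comment> \<open>Before any relation is imposed, a module over the tensor algebra is just six
    bilinear operations. Restricting this bijection to modules killed by \<open>S\<close> then
    selects the operations satisfying the laws.\<close>
  have "bij_betw ?gens {act. is_left_module ?T scaleM act} ?R"
    using bij_betw_trans[OF left_modules_of_tensor_algebra[OF vector_space_copies_scale[OF A] assms(2)]
        representation_operations_bij[OF A assms(2)]]
    by (simp add: comp_def six_tensor_algebra_def)
  then have gens: "bij_betw ?gens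
      {act \<in> {act. is_left_module ?T scaleM act}. \<forall>x\<in>S. \<forall>m. act x m = 0} {\<rho> \<in> ?R. laws \<rho>}"
  proof (rule bij_betw_Collect)
    fix act assume "act \<in> {act. is_left_module ?T scaleM act}"
    then have act: "is_left_module ?T scaleM act" by simp
    obtain lop rop where \<rho>: "?gens act = (lop, rop)" by fastforce
    have "(\<forall>x\<in>S. \<forall>m. act x m = 0) \<longleftrightarrow>
        (\<forall>(u, v)\<in>UA_relations scaleA dot. \<forall>m. act (u \<ominus>\<^bsub>?T\<^esub> v) m = 0)"
      unfolding S_def by blast
    also have "\<dots> \<longleftrightarrow> (\<forall>(u, v)\<in>UA_relations scaleA dot. \<forall>m. act u m = act v m)"
      using T.left_module_minus[OF act UA_relations_carrier] by (intro ball_cong) auto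
    finally show "laws (?gens act) \<longleftrightarrow> (\<forall>x\<in>S. \<forall>m. act x m = 0)"
      using kills_UA_relations_iff[OF act \<rho>, of dot] by (simp add: \<rho> laws_def)
  qed
  \<comment> \<open>\<open>UA_gen\<close> is the coset of \<open>six_gen\<close>, which lies in the
    carrier, so the prescribed map is the composite of the two bijections.\<close>
  have "(representation_of_module scaleA dot :: _ \<Rightarrow> _ \<times> (tri \<Rightarrow> 'm \<Rightarrow> _)) = ?gens \<circ> ?pull"
    using six_gen_carrier[of scaleA]
    by (intro ext) (simp add: representation_of_module_def representation_operations_def UA_gen_def six_gen_def)
  moreover have "{\<rho>. is_representation scaleA dot scaleM \<rho>} = {\<rho> \<in> ?R. laws \<rho>}"
    by (auto simp: is_representation_def laws_def)
  ultimately show ?thesis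
    using bij_betw_trans[OF pull gens] by (simp only:)
qed

end
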